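(* Let $X$ be a sequentially complete locally convex space, $T$ a bb-bounded linear operator on $X$, and $\lambda\in\mathbb{C}$. If $|\lambda|>r_{bb}(T)$, then the Neumann series $\sum_{i=0}^\infty \frac{T^i}{\lambda^{i+1}}$ converges uniformly on bounded sets, and its sum $R_\lambda^0$ is bb-bounded. Moreover, if $T$ is continuous, then (whenever $|\lambda|>r_{bb}(T)$) $\lambda I-T$ is invertible with $R_\lambda^0=R_\lambda=(\lambda I-T)^{-1}$, and $|\sigma^{bb}(T)|\le r_{bb}(T)$.
   Context: Spaces are over $\mathbb{C}$; locally convex spaces are Hausdorff by definition. A linear operator is bb-bounded if it maps every bounded set into a bounded set. A sequence $(S_n)$ of operators converges to zero uniformly on a set $A$ if for every zero neighborhood $V$ there is $n_0$ with $S_n(A)\subseteq V$ for all $n>n_0$; $(S_n)$ converges to $S$ uniformly on bounded sets if $(S_n-S)$ converges to zero uniformly on every bounded set; convergence of a series means convergence of its partial sums. $\rho^{bb}(T)$ is the set of $\lambda\in\mathbb{C}$ for which $\lambda I-T$ has a (two-sided) inverse which is bb-bounded; $\sigma^{bb}(T)=\mathbb{C}\setminus\rho^{bb}(T)$; $R_\lambda$ denotes the inverse of $\lambda I-T$ when it exists. For $\sigma\subseteq\mathbb{C}$, $|\sigma|=\sup\{|\lambda| : \lambda\in\sigma\}$, with $\sup\emptyset=0$. The spectral radius is $$r_{bb}(T)=\inf\Bigl\{\nu>0 : \tfrac{T^n}{\nu^n}\to 0 \text{ uniformly on every bounded set}\Bigr\},$$ with $\inf\emptyset=\infty$. *)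

theory Defs
  imports "HOL-Analysis.Analysis"
begin

definition zero_nbhd :: "'a::{topological_space, zero} set \<Rightarrow> bool" where
  "zero_nbhd V \<longleftrightarrow> 0 \<in> interior V"

text \<open>
  The distribution has no type class of complex vector spaces, so the complex scalar
  multiplication is an explicit parameter \<open>smul\<close> throughout, and the library constant
  \<open>convex\<close> (which refers to a real vector space class) is replaced by its analogue for \<open>smul\<close>.
\<close>

definition convex_wrt :: "(complex \<Rightarrow> 'a::ab_group_add \<Rightarrow> 'a) \<Rightarrow> 'a set \<Rightarrow> bool" where
  "convex_wrt smul C \<longleftrightarrow>
     (\<forall>x\<in>C. \<forall>y\<in>C. \<forall>u\<ge>0. \<forall>v\<ge>0. u + v = 1 \<longrightarrow>
        smul (complex_of_real u) x + smul (complex_of_real v) y \<in> C)"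

text \<open>Continuity of addition and negation, and the Hausdorff property, come from the type classes.\<close>

locale locally_convex_space = vector_space smul
  for smul :: "complex \<Rightarrow> 'a::{topological_ab_group_add, t2_space} \<Rightarrow> 'a" +
  assumes continuous_scale: "continuous_on UNIV (\<lambda>(c, x). smul c x)"
    and convex_zero_nbhd_base:
      "zero_nbhd U \<Longrightarrow> \<exists>C. zero_nbhd C \<and> convex_wrt smul C \<and> C \<subseteq> U"

definition tvs_Cauchy :: "(nat \<Rightarrow> 'a::{topological_space, ab_group_add}) \<Rightarrow> bool" where
  "tvs_Cauchy x \<longleftrightarrow>
     (\<forall>V. zero_nbhd V \<longrightarrow> (\<exists>N. \<forall>m\<ge>N. \<forall>n\<ge>N. x m - x n \<in> V))"

locale seq_complete_locally_convex_space = locally_convex_space smul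
  for smul :: "complex \<Rightarrow> 'a::{topological_ab_group_add, t2_space} \<Rightarrow> 'a" +
  assumes Cauchy_imp_convergent: "tvs_Cauchy (x :: nat \<Rightarrow> 'a) \<Longrightarrow> convergent x"

definition tvs_bounded ::
    "(complex \<Rightarrow> 'a::{topological_space, ab_group_add} \<Rightarrow> 'a) \<Rightarrow> 'a set \<Rightarrow> bool" where
  "tvs_bounded smul A \<longleftrightarrow>
     (\<forall>V. zero_nbhd V \<longrightarrow>
        (\<exists>s>0. \<forall>t>s. A \<subseteq> smul (complex_of_real t) ` V))"

definition bb_bounded ::
    "(complex \<Rightarrow> 'a::{topological_space, ab_group_add} \<Rightarrow> 'a) \<Rightarrow> ('a \<Rightarrow> 'a) \<Rightarrow> bool" where
  "bb_bounded smul T \<longleftrightarrow> (\<forall>A. tvs_bounded smul A \<longrightarrow> tvs_bounded smul (T ` A))"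

definition unif_to_zero_on ::
    "'a set \<Rightarrow> (nat \<Rightarrow> 'a \<Rightarrow> 'a::{topological_space, zero}) \<Rightarrow> bool" where
  "unif_to_zero_on A S \<longleftrightarrow>
     (\<forall>V. zero_nbhd V \<longrightarrow> (\<exists>n0. \<forall>n>n0. S n ` A \<subseteq> V))"

definition unif_on_bounded_to ::
    "(complex \<Rightarrow> 'a::{topological_space, ab_group_add} \<Rightarrow> 'a) \<Rightarrow>
     (nat \<Rightarrow> 'a \<Rightarrow> 'a) \<Rightarrow> ('a \<Rightarrow> 'a) \<Rightarrow> bool" where
  "unif_on_bounded_to smul S R \<longleftrightarrow>
     (\<forall>A. tvs_bounded smul A \<longrightarrow> unif_to_zero_on A (\<lambda>n x. S n x - R x))"

definition r_bb ::
    "(complex \<Rightarrow> 'a::{topological_space, ab_group_add} \<Rightarrow> 'a) \<Rightarrow> ('a \<Rightarrow> 'a) \<Rightarrow> ennreal" where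
  "r_bb smul T =
     Inf {ennreal \<nu> | \<nu>. \<nu> > 0 \<and>
       (\<forall>A. tvs_bounded smul A \<longrightarrow>
          unif_to_zero_on A (\<lambda>n x. smul (complex_of_real (1 / \<nu> ^ n)) ((T ^^ n) x)))}"

definition lambda_minus ::
    "(complex \<Rightarrow> 'a::ab_group_add \<Rightarrow> 'a) \<Rightarrow> ('a \<Rightarrow> 'a) \<Rightarrow> complex \<Rightarrow> 'a \<Rightarrow> 'a" where
  "lambda_minus smul T lam = (\<lambda>x. smul lam x - T x)"

definition resolvent_op ::
    "(complex \<Rightarrow> 'a::ab_group_add \<Rightarrow> 'a) \<Rightarrow> ('a \<Rightarrow> 'a) \<Rightarrow> complex \<Rightarrow> 'a \<Rightarrow> 'a" where
  "resolvent_op smul T lam = inv (lambda_minus smul T lam)"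

definition rho_bb ::
    "(complex \<Rightarrow> 'a::{topological_space, ab_group_add} \<Rightarrow> 'a) \<Rightarrow> ('a \<Rightarrow> 'a) \<Rightarrow> complex set" where
  "rho_bb smul T =
     {lam. bij (lambda_minus smul T lam) \<and> bb_bounded smul (resolvent_op smul T lam)}"

definition sigma_bb ::
    "(complex \<Rightarrow> 'a::{topological_space, ab_group_add} \<Rightarrow> 'a) \<Rightarrow> ('a \<Rightarrow> 'a) \<Rightarrow> complex set" where
  "sigma_bb smul T = - rho_bb smul T"

text \<open>In \<open>ennreal\<close>, the supremum of the empty set is \<open>0\<close> and the infimum of it is \<open>\<infinity>\<close>.\<close>

definition set_radius :: "complex set \<Rightarrow> ennreal" where
  "set_radius \<sigma> = (SUP z\<in>\<sigma>. ennreal (cmod z))"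

definition neumann_partial_sum ::
    "(complex \<Rightarrow> 'a::ab_group_add \<Rightarrow> 'a) \<Rightarrow> ('a \<Rightarrow> 'a) \<Rightarrow> complex \<Rightarrow> nat \<Rightarrow> 'a \<Rightarrow> 'a" where
  "neumann_partial_sum smul T lam n = (\<lambda>x. \<Sum>i\<le>n. smul (1 / lam ^ (i + 1)) ((T ^^ i) x))"

end

theory Submission
  imports Defs
begin

text \<open>
  Choose \<open>\<nu> < cmod lam\<close> such that \<open>T\<^sup>n / \<nu>\<^sup>n\<close> tends to \<open>0\<close> uniformly on bounded sets. If \<open>C\<close> is a
  convex and \<open>W \<subseteq> C\<close> a balanced zero neighborhood, the late terms of the Neumann series on a
  bounded set lie in \<open>(\<nu> / cmod lam)\<^sup>i / cmod lam\<close> times \<open>W\<close>; as these factors are summable, late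
  blocks of the series lie in \<open>C\<close>. Hence the partial sums \<open>S\<^sub>n\<close> are uniformly Cauchy on bounded
  sets. Passing to the limit in \<open>S\<^sub>n \<circ> T = T \<circ> S\<^sub>n = lam S\<^sub>n\<^sub>+\<^sub>1 - id\<close> shows that the sum inverts
  \<open>lam - T\<close>; continuity of \<open>T\<close> enters only through \<open>T (lim S\<^sub>n x) = lim T (S\<^sub>n x)\<close>.
\<close>

section \<open>Zero neighborhoods and balanced sets\<close>

definition balanced_wrt :: "(complex \<Rightarrow> 'a \<Rightarrow> 'a) \<Rightarrow> 'a set \<Rightarrow> bool" where
  "balanced_wrt smul W \<longleftrightarrow> (\<forall>c x. cmod c \<le> 1 \<longrightarrow> x \<in> W \<longrightarrow> smul c x \<in> W)"

lemma balanced_wrtD: "balanced_wrt smul W \<Longrightarrow> cmod c \<le> 1 \<Longrightarrow> x \<in> W \<Longrightarrow> smul c x \<in> W"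
  by (simp add: balanced_wrt_def)

lemma zero_nbhd_Int: "zero_nbhd U \<Longrightarrow> zero_nbhd V \<Longrightarrow> zero_nbhd (U \<inter> V)"
  by (simp add: zero_nbhd_def)

lemma zero_nbhd_open: "open U \<Longrightarrow> 0 \<in> U \<Longrightarrow> zero_nbhd U"
  by (simp add: zero_nbhd_def interior_open)

lemma zero_nbhd_superset: "open U \<Longrightarrow> 0 \<in> U \<Longrightarrow> U \<subseteq> V \<Longrightarrow> zero_nbhd V"
  unfolding zero_nbhd_def by (meson interior_maximal subsetD)

lemma zero_nbhd_zero: "zero_nbhd V \<Longrightarrow> 0 \<in> V"
  using interior_subset by (auto simp: zero_nbhd_def)

lemma tendsto_eventually_zero_nbhd:
  fixes L :: "'a::topological_ab_group_add"
  assumes "(X \<longlongrightarrow> L) F" "zero_nbhd V"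
  shows "eventually (\<lambda>n. X n - L \<in> V) F"
proof -
  have "((\<lambda>n. X n - L) \<longlongrightarrow> L - L) F"
    by (intro tendsto_intros assms)
  then have "eventually (\<lambda>n. X n - L \<in> interior V) F"
    using assms(2) by (intro topological_tendstoD) (auto simp: zero_nbhd_def)
  then show ?thesis
    by (rule eventually_mono) (use interior_subset in auto)
qed

context locally_convex_space
begin

lemma continuous_on_scale [continuous_intros]:
  assumes "continuous_on S f" "continuous_on S g"
  shows "continuous_on S (\<lambda>x. smul (f x) (g x))"
proof -
  have "continuous_on S ((\<lambda>(c, x). smul c x) \<circ> (\<lambda>x. (f x, g x)))"
    by (intro continuous_on_compose continuous_on_Pair assms
        continuous_on_subset[OF continuous_scale]) auto
  then show ?thesis by (simp add: o_def)
qed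

lemma tendsto_scale:
  assumes "(X \<longlongrightarrow> L) F"
  shows "((\<lambda>n. smul c (X n)) \<longlongrightarrow> smul c L) F"
  by (rule continuous_on_tendsto_compose[OF _ assms, of UNIV "smul c"])
    (auto intro!: continuous_intros)

text \<open>Multiplication by a nonzero scalar is invertible, so a dilate becomes a preimage, to
  which continuity applies.\<close>

lemma image_smul_conv_vimage:
  assumes "c \<noteq> 0"
  shows "smul c ` B = smul (inverse c) -` B"
proof (intro set_eqI iffI)
  fix x assume "x \<in> smul (inverse c) -` B"
  then have "smul c (smul (inverse c) x) \<in> smul c ` B" by blast
  then show "x \<in> smul c ` B" using assms by simp
qed (use assms in auto)

lemma open_image_smul:
  assumes "open B" "c \<noteq> 0"
  shows "open (smul c ` B)"
  unfolding image_smul_conv_vimage[OF assms(2)]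
  by (intro open_vimage assms continuous_intros)

text \<open>Continuity of scalar multiplication at \<open>(0, 0)\<close> gives a disc of scalars and
  an open \<open>B\<close> whose products all stay in \<open>V\<close>. The set of these products is
  closed under scalars of modulus at most 1.\<close>

lemma balanced_zero_nbhd:
  assumes "zero_nbhd V"
  obtains W where "zero_nbhd W" "balanced_wrt smul W" "W \<subseteq> V"
proof -
  let ?S = "(\<lambda>(c, x). smul c x) -` interior V"
  have "open ?S" "(0, 0) \<in> ?S"
    using assms by (auto simp: zero_nbhd_def intro!: open_vimage continuous_scale)
  then obtain A B where AB: "open A" "open B" "(0, 0) \<in> A \<times> B" "A \<times> B \<subseteq> ?S"
    by (rule open_prod_elim)
  then obtain e where e: "e > 0" "ball 0 e \<subseteq> A"
    by (meson mem_Sigma_iff openE)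
  define W where "W = {smul c x | c x. cmod c < e \<and> x \<in> B}"
  show ?thesis
  proof
    \<comment> \<open>A nonzero scalar inside the disc: the single dilate of \<open>B\<close> by
      \<open>?d\<close> is already an open set around 0 contained in \<open>W\<close>.\<close>
    let ?d = "complex_of_real (e / 2)"
    have "0 \<in> smul ?d ` B"
      using AB(3) by (intro image_eqI[of _ _ 0]) auto
    moreover have "smul ?d ` B \<subseteq> W"
      using e(1) unfolding W_def by (force simp: norm_divide)
    ultimately show "zero_nbhd W"
      using zero_nbhd_superset[OF open_image_smul[of B ?d]] AB(2) e(1) by simp
    show "balanced_wrt smul W"
      unfolding balanced_wrt_def
    proof (intro allI impI)
      fix c y assume c: "cmod c \<le> 1" and "y \<in> W"
      then obtain d x where d: "y = smul d x" "cmod d < e" "x \<in> B"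
        by (auto simp: W_def)
      have "cmod (c * d) \<le> 1 * cmod d"
        unfolding norm_mult using c by (intro mult_right_mono) auto
      then show "smul c y \<in> W"
        using d unfolding W_def by (intro CollectI exI[of _ "c * d"] exI[of _ x]) auto
    qed
    show "W \<subseteq> V"
    proof
      fix y assume "y \<in> W"
      then obtain d x where "y = smul d x" "cmod d < e" "x \<in> B"
        by (auto simp: W_def)
      moreover from this have "(d, x) \<in> ?S"
        using AB(4) e(2) by (auto simp: subset_iff)
      ultimately show "y \<in> V"
        using interior_subset by auto
    qed
  qed
qed

text \<open>The substitute for halving epsilon: continuity of addition at \<open>(0, 0)\<close>,
  followed by shrinking to a balanced set.\<close>

lemma balanced_zero_nbhd_add:
  assumes "zero_nbhd V"
  obtains W where "zero_nbhd W" "balanced_wrt smul W" "\<And>x y. x \<in> W \<Longrightarrow> y \<in> W \<Longrightarrow> x + y \<in> V"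
proof -
  let ?S = "(\<lambda>(x, y). x + y) -` interior V :: ('a \<times> 'a) set"
  have "continuous_on UNIV (\<lambda>(x, y). x + y :: 'a)"
    unfolding case_prod_unfold by (intro continuous_intros)
  then have "open ?S" "(0, 0) \<in> ?S"
    using assms by (auto simp: zero_nbhd_def intro!: open_vimage)
  then obtain A B where AB: "open A" "open B" "(0, 0) \<in> A \<times> B" "A \<times> B \<subseteq> ?S"
    by (rule open_prod_elim)
  then have "zero_nbhd (A \<inter> B)"
    by (intro zero_nbhd_Int zero_nbhd_open) auto
  then obtain W where W: "zero_nbhd W" "balanced_wrt smul W" "W \<subseteq> A \<inter> B"
    by (rule balanced_zero_nbhd)
  show ?thesis
  proof (rule that[OF W(1,2)])
    fix x y assume "x \<in> W" "y \<in> W"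
    then have "(x, y) \<in> ?S" using W(3) AB(4) by blast
    then show "x + y \<in> V" using interior_subset by auto
  qed
qed

lemma balanced_image_smul_mono:
  assumes "balanced_wrt smul W" "cmod c \<le> cmod d" "d \<noteq> 0"
  shows "smul c ` W \<subseteq> smul d ` W"
proof (clarify)
  fix x assume "x \<in> W"
  then have "smul (c / d) x \<in> W"
    using assms by (intro balanced_wrtD[OF assms(1)]) (auto simp: norm_divide divide_simps)
  then have "smul d (smul (c / d) x) \<in> smul d ` W" by blast
  then show "smul c x \<in> smul d ` W" using assms(3) by simp
qed

section \<open>Bounded sets\<close>

text \<open>Dilates of a balanced set grow with the modulus of the factor, so a single complex
  factor accounts for all large real ones.\<close>

lemma tvs_boundedI:
  assumes "\<And>V. zero_nbhd V \<Longrightarrow> balanced_wrt smul V \<Longrightarrow> \<exists>c. A \<subseteq> smul c ` V"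
  shows "tvs_bounded smul A"
  unfolding tvs_bounded_def
proof (intro allI impI)
  fix V :: "'a set" assume "zero_nbhd V"
  then obtain W where W: "zero_nbhd W" "balanced_wrt smul W" "W \<subseteq> V"
    by (rule balanced_zero_nbhd)
  obtain c where c: "A \<subseteq> smul c ` W"
    using assms W by blast
  \<comment> \<open>The added 1 keeps the threshold positive when \<open>c = 0\<close>.\<close>
  have "A \<subseteq> smul (complex_of_real t) ` V" if "t > cmod c + 1" for t
  proof -
    have "t > 0" using that norm_ge_zero[of c] by linarith
    then have "smul c ` W \<subseteq> smul (complex_of_real t) ` W"
      using that by (intro balanced_image_smul_mono W) auto
    then show ?thesis using c W(3) by blast
  qed
  then show "\<exists>s>0. \<forall>t>s. A \<subseteq> smul (complex_of_real t) ` V"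
    by (intro exI[of _ "cmod c + 1"]) (auto simp: add_nonneg_pos)
qed

lemma tvs_boundedE:
  assumes "tvs_bounded smul A" "zero_nbhd V"
  obtains t where "t \<ge> 1" "A \<subseteq> smul (complex_of_real t) ` V"
proof -
  obtain s where "s > 0" "\<forall>t>s. A \<subseteq> smul (complex_of_real t) ` V"
    using assms unfolding tvs_bounded_def by blast
  then show ?thesis
    by (intro that[of "s + 1"]) (simp_all del: of_real_add)
qed

text \<open>By continuity of scaling at 0, some nonzero \<open>d\<close> moves \<open>x\<close> into
  \<open>V\<close>; then \<open>x\<close> lies in the dilate of \<open>V\<close> by
  \<open>inverse d\<close>. This is what makes uniform statements on bounded sets apply
  pointwise.\<close>

lemma tvs_bounded_singleton: "tvs_bounded smul {x}"
proof (rule tvs_boundedI)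
  fix V :: "'a set" assume V: "zero_nbhd V"
  have "continuous_on UNIV (\<lambda>c. smul c x)"
    by (intro continuous_intros)
  then have "open ((\<lambda>c. smul c x) -` interior V)"
    by (intro open_vimage) auto
  moreover have "0 \<in> (\<lambda>c. smul c x) -` interior V"
    using V by (simp add: zero_nbhd_def)
  ultimately obtain e where e: "e > 0" "ball 0 e \<subseteq> (\<lambda>c. smul c x) -` interior V"
    by (meson openE)
  define d where "d = complex_of_real (e / 2)"
  have "d \<in> ball 0 e" "d \<noteq> 0" using e(1) by (auto simp: d_def norm_divide)
  then have "smul d x \<in> V" using e(2) interior_subset[of V] by blast
  then have "smul (inverse d) (smul d x) \<in> smul (inverse d) ` V" by blast
  then show "\<exists>c. {x} \<subseteq> smul c ` V" using \<open>d \<noteq> 0\<close> by auto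
qed

lemma tvs_bounded_image_smul:
  assumes "tvs_bounded smul A"
  shows "tvs_bounded smul (smul c ` A)"
proof (rule tvs_boundedI)
  fix V :: "'a set" assume "zero_nbhd V"
  then obtain t where "A \<subseteq> smul (complex_of_real t) ` V"
    using tvs_boundedE[OF assms] by blast
  then have "smul c ` A \<subseteq> smul (c * complex_of_real t) ` V"
    by (force simp: subset_iff)
  then show "\<exists>c'. smul c ` A \<subseteq> smul c' ` V" by blast
qed

lemma tvs_bounded_image_add:
  assumes "tvs_bounded smul (f ` A)" "tvs_bounded smul (g ` A)"
  shows "tvs_bounded smul ((\<lambda>x. f x + g x) ` A)"
proof (rule tvs_boundedI)
  fix V :: "'a set" assume "zero_nbhd V"
  then obtain W where W: "zero_nbhd W" "balanced_wrt smul W"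
    "\<And>x y. x \<in> W \<Longrightarrow> y \<in> W \<Longrightarrow> x + y \<in> V"
    by (rule balanced_zero_nbhd_add) blast
  obtain s where s: "s \<ge> 1" "f ` A \<subseteq> smul (complex_of_real s) ` W"
    using tvs_boundedE[OF assms(1) W(1)] .
  obtain t where t: "t \<ge> 1" "g ` A \<subseteq> smul (complex_of_real t) ` W"
    using tvs_boundedE[OF assms(2) W(1)] .
  \<comment> \<open>The larger factor absorbs both dilates of the balanced \<open>W\<close>, so the
    two summands can be added inside a common dilate.\<close>
  define c where "c = complex_of_real (max s t)"
  have "smul (complex_of_real s) ` W \<subseteq> smul c ` W" "smul (complex_of_real t) ` W \<subseteq> smul c ` W"
    using s(1) t(1) by (intro balanced_image_smul_mono[OF W(2)]; simp add: c_def max_def)+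
  then have "f ` A \<subseteq> smul c ` W" "g ` A \<subseteq> smul c ` W"
    using s(2) t(2) by (meson order_trans)+
  then have "(\<lambda>x. f x + g x) ` A \<subseteq> smul c ` V"
  proof (intro image_subsetI)
    fix x assume "x \<in> A"
    then obtain u v where "f x = smul c u" "g x = smul c v" "u \<in> W" "v \<in> W"
      using \<open>f ` A \<subseteq> smul c ` W\<close> \<open>g ` A \<subseteq> smul c ` W\<close> by blast
    then show "f x + g x \<in> smul c ` V"
      using W(3) by (intro image_eqI[of _ _ "u + v"]) (auto simp: scale_right_distrib)
  qed
  then show "\<exists>c. (\<lambda>x. f x + g x) ` A \<subseteq> smul c ` V" by blast
qed

section \<open>bb-bounded operators and their uniform limits\<close>

lemma bb_bounded_funpow: "bb_bounded smul T \<Longrightarrow> bb_bounded smul (T ^^ i)"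
  by (induction i) (auto simp: bb_bounded_def simp flip: image_image)

lemma bb_bounded_neumann_partial_sum:
  assumes "bb_bounded smul T"
  shows "bb_bounded smul (neumann_partial_sum smul T lam n)"
  unfolding bb_bounded_def
proof (intro allI impI)
  fix A assume A: "tvs_bounded smul A"
  have summand: "tvs_bounded smul ((\<lambda>x. smul c ((T ^^ i) x)) ` A)" for c i
    using tvs_bounded_image_smul[of "(T ^^ i) ` A" c] bb_bounded_funpow[OF assms, of i] A
    by (auto simp: bb_bounded_def image_image)
  show "tvs_bounded smul (neumann_partial_sum smul T lam n ` A)"
    unfolding neumann_partial_sum_def
  proof (induction n)
    case 0
    show ?case using summand[of "1 / lam ^ (0 + 1)" 0] by simp
  next
    case (Suc n)
    show ?case
      using tvs_bounded_image_add[OF Suc.IH summand[of "1 / lam ^ (Suc n + 1)" "Suc n"]]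
      by (simp only: sum.atMost_Suc)
  qed
qed

text \<open>On a bounded set some \<open>S n\<close> differs from \<open>R\<close> by elements of
  \<open>W\<close>, while its image lies in \<open>t\<close> times \<open>W\<close>. Hence
  \<open>R\<close> maps the set into \<open>t\<close> times \<open>W + W\<close>, which is inside
  \<open>t\<close> times \<open>V\<close>.\<close>

lemma bb_bounded_uniform_limit:
  assumes "unif_on_bounded_to smul S R" "\<And>n. bb_bounded smul (S n)"
  shows "bb_bounded smul R"
  unfolding bb_bounded_def
proof (intro allI impI)
  fix A assume A: "tvs_bounded smul A"
  have diff: "\<exists>n. \<forall>x\<in>A. S n x - R x \<in> V" if "zero_nbhd V" for V
  proof -
    obtain n0 where "\<forall>n>n0. (\<lambda>x. S n x - R x) ` A \<subseteq> V"
      using assms(1) A \<open>zero_nbhd V\<close> unfolding unif_on_bounded_to_def unif_to_zero_on_def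
      by blast
    \<comment> \<open>The estimate holds strictly beyond \<open>n0\<close>, so \<open>Suc n0\<close>
      is the first usable index.\<close>
    then show ?thesis by (intro exI[of _ "Suc n0"]) auto
  qed
  show "tvs_bounded smul (R ` A)"
  proof (rule tvs_boundedI)
    fix V :: "'a set" assume "zero_nbhd V"
    then obtain W where W: "zero_nbhd W" "balanced_wrt smul W"
      "\<And>x y. x \<in> W \<Longrightarrow> y \<in> W \<Longrightarrow> x + y \<in> V"
      by (rule balanced_zero_nbhd_add) blast
    obtain n where n: "\<forall>x\<in>A. S n x - R x \<in> W"
      using diff[OF W(1)] by blast
    have "tvs_bounded smul (S n ` A)"
      using assms(2) A by (simp add: bb_bounded_def)
    then obtain t where t: "t \<ge> 1" "S n ` A \<subseteq> smul (complex_of_real t) ` W"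
      using tvs_boundedE[OF _ W(1)] by blast
    let ?t = "complex_of_real t"
    have "R ` A \<subseteq> smul ?t ` V"
    proof (rule image_subsetI)
      fix x assume x: "x \<in> A"
      then obtain w where w: "w \<in> W" "S n x = smul ?t w"
        using t by blast
      \<comment> \<open>Factoring out \<open>?t\<close> leaves the difference with coefficient
        \<open>- 1 / ?t\<close>, of modulus at most 1 because \<open>t \<ge> 1\<close>.\<close>
      have "smul (- 1 / ?t) (S n x - R x) \<in> W"
        using n x t(1) by (intro balanced_wrtD[OF W(2)]) (auto simp: norm_divide)
      then have "w + smul (- 1 / ?t) (S n x - R x) \<in> V"
        using W(3) w by blast
      moreover have "R x = smul ?t (w + smul (- 1 / ?t) (S n x - R x))"
        using w(2) t(1) by (simp add: scale_right_diff_distrib)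
      ultimately show "R x \<in> smul ?t ` V" by (rule rev_image_eqI)
    qed
    then show "\<exists>c. R ` A \<subseteq> smul c ` V" by blast
  qed
qed

section \<open>Convex combinations and the Cauchy estimate\<close>

lemma convex_wrt_subconvex_sum:
  assumes "convex_wrt smul C" "0 \<in> C" "finite I"
    and "\<And>i. i \<in> I \<Longrightarrow> w i \<in> C" "\<And>i. i \<in> I \<Longrightarrow> c i \<ge> 0" "sum c I \<le> 1"
  shows "(\<Sum>i\<in>I. smul (complex_of_real (c i)) (w i)) \<in> C"
proof -
  \<comment> \<open>Writing the sum as its total weight times a point of \<open>C\<close> is a claim
    that survives induction, since it does not fix the total weight.\<close>
  have "\<exists>y\<in>C. (\<Sum>i\<in>I. smul (complex_of_real (c i)) (w i)) = smul (complex_of_real (sum c I)) y"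
    using assms(3-5)
  proof (induction I rule: finite_induct)
    case empty
    then show ?case using assms(2) by auto
  next
    case (insert a I)
    then obtain y where y: "y \<in> C"
      "(\<Sum>i\<in>I. smul (complex_of_real (c i)) (w i)) = smul (complex_of_real (sum c I)) y"
      by auto
    define s where "s = c a + sum c I"
    have nonneg: "c a \<ge> 0" "sum c I \<ge> 0"
      using insert.prems by (auto intro: sum_nonneg)
    show ?case
    proof (cases "s = 0")
      case True
      then have "c a = 0" "sum c I = 0" using nonneg by (auto simp: s_def)
      then show ?thesis using y insert.hyps by auto
    next
      case False
      \<comment> \<open>The weighted mean of the new point and the old \<open>y\<close>, normalized
        by the new total weight \<open>s\<close>.\<close>
      let ?y = "smul (complex_of_real (c a / s)) (w a) + smul (complex_of_real (sum c I / s)) y"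
      have "?y \<in> C"
      proof -
        have "c a / s \<ge> 0" "sum c I / s \<ge> 0" using nonneg by (auto simp: s_def)
        moreover have "c a / s + sum c I / s = 1"
          using False by (simp add: s_def flip: add_divide_distrib)
        ultimately show ?thesis
          using assms(1) y(1) insert.prems(1) unfolding convex_wrt_def by blast
      qed
      moreover have "smul (complex_of_real s) ?y =
          smul (complex_of_real (c a)) (w a) + smul (complex_of_real (sum c I)) y"
        using False by (simp add: scale_right_distrib)
      ultimately show ?thesis
        using insert.hyps y(2) by (intro bexI[of _ ?y]) (simp_all add: s_def)
    qed
  qed
  then obtain y where y: "y \<in> C"
    "(\<Sum>i\<in>I. smul (complex_of_real (c i)) (w i)) = smul (complex_of_real (sum c I)) y" by blast
  have "sum c I \<ge> 0" using assms(5) by (rule sum_nonneg)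
  \<comment> \<open>The missing weight is placed on the point 0 of \<open>C\<close>.\<close>
  then have "smul (complex_of_real (sum c I)) y + smul (complex_of_real (1 - sum c I)) 0 \<in> C"
    using assms(2,6) y(1)
    by (intro assms(1)[unfolded convex_wrt_def, rule_format]) simp_all
  then show ?thesis using y(2) by simp
qed

lemma neumann_series_uniformly_Cauchy:
  assumes "\<nu> > 0" "\<nu> < cmod lam"
    and "unif_to_zero_on A (\<lambda>n x. smul (complex_of_real (1 / \<nu> ^ n)) ((T ^^ n) x))"
    and "zero_nbhd V"
  obtains N where "\<And>m n x. N \<le> m \<Longrightarrow> m \<le> n \<Longrightarrow> x \<in> A \<Longrightarrow>
    neumann_partial_sum smul T lam n x - neumann_partial_sum smul T lam m x \<in> V"
proof -
  obtain C where C: "zero_nbhd C" "convex_wrt smul C" "C \<subseteq> V"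
    using convex_zero_nbhd_base[OF assms(4)] by blast
  obtain W where W: "zero_nbhd W" "balanced_wrt smul W" "W \<subseteq> C"
    using balanced_zero_nbhd[OF C(1)] .
  obtain n0 where n0: "\<And>n x. n > n0 \<Longrightarrow> x \<in> A \<Longrightarrow>
      smul (complex_of_real (1 / \<nu> ^ n)) ((T ^^ n) x) \<in> W"
    using assms(3) W(1) unfolding unif_to_zero_on_def by blast
  \<comment> \<open>Here \<open>c i\<close> equals \<open>\<nu>^i / cmod lam^(i+1)\<close>: the
    modulus of the Neumann coefficient times the factor \<open>\<nu>^i\<close> that undoes the
    normalization of the iterates. It is geometric with ratio below 1.\<close>
  define c where "c i = (\<nu> / cmod lam) ^ i / cmod lam" for i
  have c_nonneg: "c i \<ge> 0" for i
    using assms(1) by (simp add: c_def)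
  have "summable c"
    unfolding c_def using assms(1,2)
    by (intro summable_divide summable_geometric) (auto simp: divide_less_eq)
  then obtain N1 where N1: "\<And>m n. m \<ge> N1 \<Longrightarrow> norm (sum c {m..<n}) < 1"
    unfolding summable_Cauchy using zero_less_one by blast
  show ?thesis
  proof (rule that[of "max n0 N1"])
    fix m n x assume mn: "max n0 N1 \<le> m" "m \<le> n" and x: "x \<in> A"
    \<comment> \<open>The coefficient in front has modulus 1 and carries the phase of the Neumann
      coefficient. The balanced \<open>W\<close> absorbs it, leaving the nonnegative real weight
      \<open>c i\<close> that convexity requires.\<close>
    define w where "w i = smul (of_real (cmod lam) ^ (i + 1) / lam ^ (i + 1))
        (smul (complex_of_real (1 / \<nu> ^ i)) ((T ^^ i) x))" for i
    have "lam \<noteq> 0" using assms(1,2) by auto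
    have w_term: "smul (1 / lam ^ (i + 1)) ((T ^^ i) x) = smul (complex_of_real (c i)) (w i)" for i
      using assms(1) \<open>lam \<noteq> 0\<close> by (simp add: w_def c_def field_simps)
    have w_mem: "w i \<in> C" if "i \<in> {m<..n}" for i
    proof -
      have "w i \<in> W"
        unfolding w_def using that mn x \<open>lam \<noteq> 0\<close>
        by (intro balanced_wrtD[OF W(2)] n0) (auto simp: norm_divide norm_mult norm_power)
      then show ?thesis using W(3) by blast
    qed
    \<comment> \<open>The Cauchy criterion speaks of blocks closed on the left and open on the
      right, hence the shift of both ends.\<close>
    have "{m<..n} = {Suc m..<Suc n}" by auto
    then have "sum c {m<..n} \<le> 1"
      using N1[of "Suc m" "Suc n"] mn by simp
    then have "(\<Sum>i\<in>{m<..n}. smul (complex_of_real (c i)) (w i)) \<in> C"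
      using C(2) zero_nbhd_zero[OF C(1)] w_mem c_nonneg by (intro convex_wrt_subconvex_sum) auto
    moreover have "neumann_partial_sum smul T lam n x - neumann_partial_sum smul T lam m x
        = (\<Sum>i\<in>{..n} - {..m}. smul (1 / lam ^ (i + 1)) ((T ^^ i) x))"
      unfolding neumann_partial_sum_def using mn(2) by (subst sum_diff) auto
    moreover have "{..n} - {..m} = {m<..n}" by auto
    ultimately show "neumann_partial_sum smul T lam n x - neumann_partial_sum smul T lam m x \<in> V"
      using C(3) by (auto simp only: w_term)
  qed
qed

section \<open>Algebra and linearity of the partial sums\<close>

text \<open>Term \<open>i\<close> at \<open>T x\<close> is \<open>lam\<close> times term
  \<open>i + 1\<close> at \<open>x\<close>; the subtracted \<open>x\<close> is \<open>lam\<close>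
  times the term of index 0.\<close>

lemma neumann_partial_sum_comp:
  assumes "lam \<noteq> 0"
  shows "neumann_partial_sum smul T lam n (T x) =
    smul lam (neumann_partial_sum smul T lam (Suc n) x) - x"
  unfolding neumann_partial_sum_def sum.atMost_Suc_shift
  using assms
  by (simp add: scale_right_distrib scale_sum_right funpow_swap1)

lemma linear_endoI:
  assumes "\<And>x y. f (x + y) = f x + f y" "\<And>c x. f (smul c x) = smul c (f x)"
  shows "Vector_Spaces.linear smul smul f"
  by (intro Vector_Spaces.linear.intro vector_space_axioms module_hom.intro module_axioms
      module_hom_axioms.intro assms)

lemma linear_funpow:
  assumes "Vector_Spaces.linear smul smul T"
  shows "Vector_Spaces.linear smul smul (T ^^ i)"
proof (induction i)
  case 0
  show ?case using vector_space_axioms by (simp add: linear_id id_def[symmetric])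
next
  case (Suc i)
  then show ?case unfolding funpow.simps by (rule Vector_Spaces.linear_compose) (rule assms)
qed

lemma linear_neumann_partial_sum:
  assumes "Vector_Spaces.linear smul smul T"
  shows "Vector_Spaces.linear smul smul (neumann_partial_sum smul T lam n)"
proof -
  note hom = linear_funpow[OF assms, THEN Vector_Spaces.linear.axioms(3)]
  show ?thesis
    unfolding neumann_partial_sum_def
    by (intro linear_endoI)
      (simp_all add: module_hom.add[OF hom] module_hom.scale[OF hom] scale_right_distrib
        sum.distrib scale_sum_right mult.commute)
qed

lemma neumann_partial_sum_commute:
  assumes "Vector_Spaces.linear smul smul T"
  shows "T (neumann_partial_sum smul T lam n x) = neumann_partial_sum smul T lam n (T x)"
proof -
  note hom = assms[THEN Vector_Spaces.linear.axioms(3)]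
  show ?thesis
    by (simp add: neumann_partial_sum_def module_hom.sum[OF hom] module_hom.scale[OF hom]
        funpow_swap1)
qed

end

section \<open>Convergence of the series and the resolvent\<close>

context seq_complete_locally_convex_space
begin

text \<open>The Cauchy estimate on singletons produces the pointwise limit; applied to a bounded
  set, it makes that convergence uniform.\<close>

lemma neumann_series_converges:
  assumes "\<nu> > 0" "\<nu> < cmod lam"
    and lim: "\<And>A. tvs_bounded smul A \<Longrightarrow>
      unif_to_zero_on A (\<lambda>n x. smul (complex_of_real (1 / \<nu> ^ n)) ((T ^^ n) x))"
  obtains R where "unif_on_bounded_to smul (neumann_partial_sum smul T lam) R"
    and "\<And>x. (\<lambda>n. neumann_partial_sum smul T lam n x) \<longlonglongrightarrow> R x"
proof -
  let ?S = "neumann_partial_sum smul T lam"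
  define R where "R x = lim (\<lambda>n. ?S n x)" for x
  have R: "(\<lambda>n. ?S n x) \<longlonglongrightarrow> R x" for x
  proof -
    have "tvs_Cauchy (\<lambda>n. ?S n x)"
      unfolding tvs_Cauchy_def
    proof (intro allI impI)
      fix V :: "'a set" assume "zero_nbhd V"
      then obtain W where W: "zero_nbhd W" "balanced_wrt smul W" "W \<subseteq> V"
        by (rule balanced_zero_nbhd)
      obtain N where N: "\<And>m n y. N \<le> m \<Longrightarrow> m \<le> n \<Longrightarrow> y \<in> {x} \<Longrightarrow> ?S n y - ?S m y \<in> W"
        using neumann_series_uniformly_Cauchy[OF assms(1,2) lim[OF tvs_bounded_singleton] W(1)]
        by blast
      have "?S m x - ?S n x \<in> W" if "m \<ge> N" "n \<ge> N" for m n
      \<comment> \<open>The estimate covers one order of the indices; multiplying by -1 inside the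
        balanced \<open>W\<close> gives the other.\<close>
      proof (cases "n \<le> m")
        case True
        then show ?thesis using N that by simp
      next
        case False
        then have "smul (- 1) (?S n x - ?S m x) \<in> W"
          using N that by (intro balanced_wrtD[OF W(2)]) auto
        then show ?thesis by simp
      qed
      then show "\<exists>N. \<forall>m\<ge>N. \<forall>n\<ge>N. ?S m x - ?S n x \<in> V"
        using W(3) by blast
    qed
    then show ?thesis
      unfolding R_def using Cauchy_imp_convergent convergent_LIMSEQ_iff by blast
  qed
  moreover have "unif_on_bounded_to smul ?S R"
    unfolding unif_on_bounded_to_def unif_to_zero_on_def
  proof (intro allI impI)
    fix A V assume A: "tvs_bounded smul A" and "zero_nbhd (V :: 'a set)"
    then obtain W where W: "zero_nbhd W" "balanced_wrt smul W"
      "\<And>x y. x \<in> W \<Longrightarrow> y \<in> W \<Longrightarrow> x + y \<in> V"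
      using balanced_zero_nbhd_add by metis
    obtain N where N: "\<And>m n x. N \<le> m \<Longrightarrow> m \<le> n \<Longrightarrow> x \<in> A \<Longrightarrow> ?S n x - ?S m x \<in> W"
      using neumann_series_uniformly_Cauchy[OF assms(1,2) lim[OF A] W(1)] by blast
    have "?S n x - R x \<in> V" if n: "n > N" and x: "x \<in> A" for n x
    proof -
      \<comment> \<open>The auxiliary index \<open>m\<close> may depend on \<open>x\<close>, but
        \<open>N\<close> does not, so the resulting bound is uniform on \<open>A\<close>.\<close>
      have "eventually (\<lambda>m. ?S m x - R x \<in> W \<and> m \<ge> n) sequentially"
        by (intro eventually_conj tendsto_eventually_zero_nbhd R W eventually_ge_at_top)
      then obtain m where m: "?S m x - R x \<in> W" "m \<ge> n"
        using eventually_happens'[OF sequentially_bot] by blast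
      have "smul (- 1) (?S m x - ?S n x) \<in> W"
        using N n m x by (intro balanced_wrtD[OF W(2)]) auto
      from W(3)[OF this m(1)] show ?thesis by simp
    qed
    then show "\<exists>n0. \<forall>n>n0. (\<lambda>x. ?S n x - R x) ` A \<subseteq> V" by blast
  qed
  ultimately show ?thesis using that by blast
qed

text \<open>Addition and scaling are continuous and limits are unique in a Hausdorff space, so both
  identities pass to the limit.\<close>

lemma linear_pointwise_limit:
  assumes "\<And>n. Vector_Spaces.linear smul smul (S n)" "\<And>x. (\<lambda>n. S n x) \<longlonglongrightarrow> R x"
  shows "Vector_Spaces.linear smul smul R"
proof (rule linear_endoI)
  note hom = assms(1)[THEN Vector_Spaces.linear.axioms(3)]
  show "R (x + y) = R x + R y" for x y
    using tendsto_add[OF assms(2)[of x] assms(2)[of y]] assms(2)[of "x + y"]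
    by (intro LIMSEQ_unique[of "\<lambda>n. S n (x + y)"]) (simp_all add: module_hom.add[OF hom])
  show "R (smul c x) = smul c (R x)" for c x
    using tendsto_scale[OF assms(2)[of x], of c] assms(2)[of "smul c x"]
    by (intro LIMSEQ_unique[of "\<lambda>n. S n (smul c x)"]) (simp_all add: module_hom.scale[OF hom])
qed

lemma neumann_series_resolvent:
  assumes "Vector_Spaces.linear smul smul T" "continuous_on UNIV T" "lam \<noteq> 0"
    and R: "\<And>x. (\<lambda>n. neumann_partial_sum smul T lam n x) \<longlonglongrightarrow> R x"
    and "Vector_Spaces.linear smul smul R"
  shows "bij (lambda_minus smul T lam)" "R = resolvent_op smul T lam"
proof -
  let ?S = "neumann_partial_sum smul T lam"
  let ?L = "lambda_minus smul T lam"
  note hom = assms(5)[THEN Vector_Spaces.linear.axioms(3)]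
  have lim: "(\<lambda>n. ?S n (T x)) \<longlonglongrightarrow> smul lam (R x) - x" for x
    unfolding neumann_partial_sum_comp[OF assms(3)]
    by (intro tendsto_diff tendsto_scale LIMSEQ_Suc[OF R] tendsto_const)
  have left: "R (T x) = smul lam (R x) - x" for x
    using LIMSEQ_unique[OF R lim] .
  \<comment> \<open>Since \<open>T\<close> commutes with the partial sums, this is the sequence of
    \<open>lim\<close> again, now with limit \<open>T (R x)\<close>.\<close>
  have "(\<lambda>n. T (?S n x)) \<longlonglongrightarrow> T (R x)" for x
    using continuous_on_tendsto_compose[OF assms(2) R] by simp
  then have right: "T (R x) = smul lam (R x) - x" for x
    using LIMSEQ_unique[OF _ lim] neumann_partial_sum_commute[OF assms(1)] by simp
  have RL: "R (?L x) = x" and LR: "?L (R x) = x" for x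
    by (simp_all add: lambda_minus_def module_hom.diff[OF hom] module_hom.scale[OF hom] left right)
  show "bij ?L"
    using RL LR by (intro o_bij[of R]) auto
  show "R = resolvent_op smul T lam"
    unfolding resolvent_op_def using RL LR by (intro inv_equality[symmetric]) auto
qed

end

theorem theorem5p2:
  fixes smul :: "complex \<Rightarrow> 'a::{topological_ab_group_add, t2_space} \<Rightarrow> 'a"
    and T :: "'a \<Rightarrow> 'a"
  assumes "seq_complete_locally_convex_space smul"
    and "Vector_Spaces.linear smul smul T"
    and "bb_bounded smul T"
  shows "(\<forall>lam. ennreal (cmod lam) > r_bb smul T \<longrightarrow>
            (\<exists>R0. Vector_Spaces.linear smul smul R0 \<and>
                  unif_on_bounded_to smul (neumann_partial_sum smul T lam) R0 \<and>
                  bb_bounded smul R0 \<and>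
                  (continuous_on UNIV T \<longrightarrow>
                     bij (lambda_minus smul T lam) \<and> R0 = resolvent_op smul T lam)))
       \<and> (continuous_on UNIV T \<longrightarrow> set_radius (sigma_bb smul T) \<le> r_bb smul T)"
proof -
  interpret seq_complete_locally_convex_space smul by (fact assms(1))
  have main: "\<exists>R0. Vector_Spaces.linear smul smul R0 \<and>
      unif_on_bounded_to smul (neumann_partial_sum smul T lam) R0 \<and>
      bb_bounded smul R0 \<and>
      (continuous_on UNIV T \<longrightarrow>
         bij (lambda_minus smul T lam) \<and> R0 = resolvent_op smul T lam)"
    if lam: "ennreal (cmod lam) > r_bb smul T" for lam
  proof -
    \<comment> \<open>An infimum strictly below \<open>cmod lam\<close> has an admissible
      \<open>\<nu>\<close> below \<open>cmod lam\<close>.\<close>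
    obtain \<nu> where \<nu>: "\<nu> > 0" "ennreal \<nu> < ennreal (cmod lam)"
      "\<And>A. tvs_bounded smul A \<Longrightarrow>
        unif_to_zero_on A (\<lambda>n x. smul (complex_of_real (1 / \<nu> ^ n)) ((T ^^ n) x))"
      using lam unfolding r_bb_def Inf_less_iff by blast
    then have "\<nu> < cmod lam" by (simp add: ennreal_less_iff)
    then obtain R where R: "unif_on_bounded_to smul (neumann_partial_sum smul T lam) R"
      "\<And>x. (\<lambda>n. neumann_partial_sum smul T lam n x) \<longlonglongrightarrow> R x"
      using neumann_series_converges[OF \<nu>(1) _ \<nu>(3)] by blast
    have lin: "Vector_Spaces.linear smul smul R"
      using linear_pointwise_limit[OF linear_neumann_partial_sum[OF assms(2)] R(2)] .
    have "lam \<noteq> 0" using \<nu>(1) \<open>\<nu> < cmod lam\<close> by auto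
    have "bb_bounded smul R"
      using bb_bounded_uniform_limit[OF R(1) bb_bounded_neumann_partial_sum[OF assms(3)]] .
    then show ?thesis
      using R(1) lin neumann_series_resolvent[OF assms(2) _ \<open>lam \<noteq> 0\<close> R(2) lin] by blast
  qed
  moreover have "set_radius (sigma_bb smul T) \<le> r_bb smul T" if "continuous_on UNIV T"
    unfolding set_radius_def
  proof (rule SUP_least)
    fix lam assume "lam \<in> sigma_bb smul T"
    \<comment> \<open>By contraposition: were \<open>cmod lam\<close> larger, \<open>main\<close>
      would give a bb-bounded resolvent and put \<open>lam\<close> in
      \<open>rho_bb smul T\<close>.\<close>
    then show "ennreal (cmod lam) \<le> r_bb smul T"
      using main[of lam] that by (auto simp: sigma_bb_def rho_bb_def not_le[symmetric])
  qed
  ultimately show ?thesis by blast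
qed

end
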